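(* Suppose that for all $x\in\mathcal X$, $\psi(\cdot;x)$ is $\gamma$-strongly convex and $L$-Lipschitz, and its gradient $\dot\psi(\cdot;x)$ is $\beta$-Lipschitz. Let $\hat\theta_n$ be the stochastic gradient descent (SGD) estimator computed from $(X_1,\dots,X_n)$ with step sizes $\alpha_t=t^{-a}\beta^{-1}$ for some $a\in(0,1)$. If $$\frac{\gamma}{\beta}\ge\frac{a(1-a)}{1-2^{-(1-a)}}\cdot\frac{\log n}{n^{1-a}},$$ then for every $i\in\{1,\dots,n\}$, $$\left\|\nabla_i\hat\theta_n\right\|\le\frac{2L}{\beta}n^{-a}.$$
   Context: $\psi(\theta;x)$ is an objective function, $\theta\in\Theta$ with $\Theta$ a convex subset of a Euclidean space containing $0$, $x\in\mathcal X$; $\dot\psi(\theta;x)$ is the gradient with respect to $\theta$; $\|\cdot\|$ is the Euclidean norm. SGD: $\hat\theta_0=0$ and $\hat\theta_{t+1}=\hat\theta_t-\alpha_{t+1}\dot\psi(\hat\theta_t;X_{t+1})$ for $t=0,\dots,n-1$; the iterates are understood to stay in $\Theta$. The SGD estimator is $\hat\theta_n=\hat\theta_n(X_1,\dots,X_n)$. For data $\mathbf X=(X_1,\dots,X_n)$, $\mathbf X^i$ is obtained by replacing $X_i$ with another point $X_i'$ (an i.i.d. copy), and $\nabla_i\hat\theta_n=\hat\theta_n(\mathbf X)-\hat\theta_n(\mathbf X^i)$. The parameters $\gamma,\beta,L$ are positive. *)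

theory Defs
  imports "HOL-Analysis.Analysis"
begin

definition strongly_convex_on :: "real \<Rightarrow> 'a::real_inner set \<Rightarrow> ('a \<Rightarrow> real) \<Rightarrow> bool" where
  "strongly_convex_on \<gamma> S f \<longleftrightarrow> convex S \<and>
    (\<forall>x\<in>S. \<forall>y\<in>S. \<forall>u\<ge>0. \<forall>v\<ge>0. u + v = 1 \<longrightarrow>
      f (u *\<^sub>R x + v *\<^sub>R y) \<le> u * f x + v * f y - \<gamma> / 2 * u * v * (norm (x - y))\<^sup>2)"

text \<open>
  The derivative is taken within the domain \<open>S\<close>, which need not be open. This agrees with
  \<open>GDERIV\<close> at interior points and is a one-sided notion at boundary points.
\<close>
definition gradient_on :: "'a::real_inner set \<Rightarrow> ('a \<Rightarrow> real) \<Rightarrow> ('a \<Rightarrow> 'a) \<Rightarrow> bool" where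
  "gradient_on S f g \<longleftrightarrow> (\<forall>\<theta>\<in>S. (f has_derivative (\<lambda>h. h \<bullet> g \<theta>)) (at \<theta> within S))"

text \<open>
  Here \<open>g \<theta> x\<close> is the gradient of the objective in \<open>\<theta>\<close> at the data point \<open>x\<close>. Data are
  indexed from 1: the iterate with index \<open>t\<close> depends only on \<open>X 1, \<dots>, X t\<close>.
\<close>
primrec sgd :: "('a::real_vector \<Rightarrow> 'x \<Rightarrow> 'a) \<Rightarrow> (nat \<Rightarrow> real) \<Rightarrow> (nat \<Rightarrow> 'x) \<Rightarrow> nat \<Rightarrow> 'a" where
  "sgd g \<alpha> X 0 = 0"
| "sgd g \<alpha> X (Suc t) = sgd g \<alpha> X t - \<alpha> (Suc t) *\<^sub>R g (sgd g \<alpha> X t) (X (Suc t))"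

definition nabla :: "nat \<Rightarrow> 'x \<Rightarrow> ((nat \<Rightarrow> 'x) \<Rightarrow> 'a::minus) \<Rightarrow> (nat \<Rightarrow> 'x) \<Rightarrow> 'a" where
  "nabla i x' T X = T X - T (X(i := x'))"

end

theory Submission
  imports Defs
begin

text \<open>
  The two runs agree until the step \<open>i\<close> that reads the replaced data point. Gradients have norm
  at most \<open>L\<close>, so that step separates them by at most \<open>2 * L * \<alpha> i = 2 * L / \<beta> * i powr (- a)\<close>.
  Each later step applies one and the same map \<open>\<theta> \<mapsto> \<theta> - \<alpha> t *\<^sub>R g \<theta>\<close> to both runs, and such a map
  shrinks distances by the factor \<open>1 - \<alpha> t * \<gamma> = 1 - \<kappa> * t powr (- a)\<close>, where \<open>\<kappa> = \<gamma> / \<beta>\<close>. What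
  remains is the inequality \<open>i powr (- a) * (\<Prod>t\<in>{i<..n}. 1 - \<kappa> * t powr (- a)) \<le> n powr (- a)\<close>.

  The contraction (\<open>feasible_gradient_step_contracts\<close>) is the delicate part, because the domain is
  an arbitrary convex set \<open>S\<close> and the objective need not be twice differentiable. If there were a
  Hessian, its eigenvalues would lie between \<open>\<gamma>\<close> and \<open>\<beta>\<close>, and \<open>1 - \<alpha> * \<gamma>\<close> would bound the norm of
  the derivative of the step. Without a Hessian the substitute is co-coercivity of the
  gradient of the convex function \<open>\<theta> \<mapsto> (norm \<theta>)\<^sup>2 / 2 - \<alpha> * f \<theta>\<close>. Its usual proof evaluates the
  objective at auxiliary points that may lie outside \<open>S\<close>. These points are close to the given ones
  when the latter are close to each other, so the proof works locally at a positive relative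
  distance from the boundary; subdividing segments makes it global there, and continuity extends
  it to all of \<open>S\<close>.

  A second difficulty is that \<open>S\<close> may have empty interior. Then the derivative within \<open>S\<close> determines
  only the component of the gradient in \<open>span S\<close>, and the normal component is unrelated to \<open>f\<close>, so
  neither the bound by \<open>L\<close> nor the contraction need hold for it. But a gradient step from \<open>S\<close> to \<open>S\<close> has a
  gradient in \<open>span S\<close>, so along feasible runs the gradient may be replaced by its orthogonal
  projection.

  The product inequality (\<open>factor_product_from\<close>) reduces to \<open>i = 1\<close>. The factor with index \<open>t\<close> is at
  most \<open>((t - 1) / t) powr a\<close> exactly when \<open>\<kappa> \<ge> t powr a - (t - 1) powr a\<close>, and the right-hand side
  decreases in \<open>t\<close>. Hence either all factors with \<open>t > i\<close> satisfy this bound, and telescoping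
  gives the claim, or all factors with \<open>t \<le> i\<close> violate it, and then
  \<open>i powr (- a)\<close> is at most the product over \<open>{1<..i}\<close>. For \<open>i = 1\<close> the hypothesis on \<open>\<kappa>\<close> enters: with
  \<open>n \<ge> 3\<close> it suffices to use \<open>1 - x \<le> exp (- x)\<close> and an integral bound for the sum of \<open>t powr (- a)\<close>;
  \<open>n = 2\<close> needs the sharper \<open>two_powr_product_le\<close>.
\<close>

section \<open>Objectives along segments of a convex domain\<close>

text \<open>
  The derivative is taken within the segment, whose image lies in \<open>S\<close>; this is all that a gradient
  at boundary points provides.
\<close>
lemma gradient_on_segment:
  assumes "gradient_on S f g" "convex S" "x \<in> S" "y \<in> S" "t \<in> {0..1}"
  shows "((\<lambda>t. f (x + t *\<^sub>R (y - x))) has_real_derivative (y - x) \<bullet> g (x + t *\<^sub>R (y - x)))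
           (at t within {0..1})"
proof -
  have seg: "x + s *\<^sub>R (y - x) \<in> S" if "s \<in> {0..1}" for s
    using convexD_alt[of S x y s] assms(2,3,4) that by (simp add: algebra_simps)
  let ?l = "\<lambda>t::real. x + t *\<^sub>R (y - x)"
  have d1: "(?l has_derivative (\<lambda>h. h *\<^sub>R (y - x))) (at t within {0..1})"
    by (auto intro!: derivative_eq_intros)
  have "(f has_derivative (\<lambda>h. h \<bullet> g (?l t))) (at (?l t) within S)"
    using assms(1) seg[OF assms(5)] by (auto simp: gradient_on_def)
  then have d2: "(f has_derivative (\<lambda>h. h \<bullet> g (?l t))) (at (?l t) within ?l ` {0..1})"
    by (rule has_derivative_subset) (use seg in auto)
  from diff_chain_within[OF d1 d2] show ?thesis
    by (simp add: has_field_derivative_def o_def mult.commute[of _ "(y - x) \<bullet> _"]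
        mult_commute_abs)
qed

text \<open>
  Divide the strong convexity inequality at \<open>x + t *\<^sub>R (y - x)\<close> by \<open>t\<close> and let \<open>t\<close> tend to \<open>0\<close> from the
  right.
\<close>
lemma strongly_convex_first_order:
  assumes "gradient_on S f g" "strongly_convex_on \<gamma> S f" "x \<in> S" "y \<in> S"
  shows "f x + (y - x) \<bullet> g x + \<gamma> / 2 * (norm (y - x))\<^sup>2 \<le> f y"
proof -
  have cS: "convex S" using assms(2) by (simp add: strongly_convex_on_def)
  define \<phi> where "\<phi> t = f (x + t *\<^sub>R (y - x))" for t :: real
  have "(\<phi> has_real_derivative (y - x) \<bullet> g x) (at 0 within {0..1})"
    using gradient_on_segment[OF assms(1) cS assms(3,4), of 0] by (simp add: \<phi>_def[abs_def])
  then have lim: "((\<lambda>t. (\<phi> t - \<phi> 0) / t) \<longlongrightarrow> (y - x) \<bullet> g x) (at 0 within {0..1})"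
    by (simp add: has_field_derivative_iff)
  have lim2: "((\<lambda>t. f y - f x - \<gamma> / 2 * (1 - t) * (norm (y - x))\<^sup>2) \<longlongrightarrow>
      f y - f x - \<gamma> / 2 * (1 - 0) * (norm (y - x))\<^sup>2) (at 0 within {0..1})"
    by (intro tendsto_intros)
  have "(y - x) \<bullet> g x \<le> f y - f x - \<gamma> / 2 * (1 - 0) * (norm (y - x))\<^sup>2"
  proof (rule tendsto_le[OF _ lim2 lim])
    show "at 0 within {0..1::real} \<noteq> bot" by (simp add: trivial_limit_within islimpt_Icc)
    have "(\<phi> t - \<phi> 0) / t \<le> f y - f x - \<gamma> / 2 * (1 - t) * (norm (y - x))\<^sup>2"
      if "t \<in> {0..1}" "t \<noteq> 0" for t
    proof -
      have "f (t *\<^sub>R y + (1 - t) *\<^sub>R x) \<le> t * f y + (1 - t) * f x - \<gamma> / 2 * t * (1 - t) * (norm (y - x))\<^sup>2"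
        using assms that by (auto simp: strongly_convex_on_def)
      moreover have "t *\<^sub>R y + (1 - t) *\<^sub>R x = x + t *\<^sub>R (y - x)" by (simp add: algebra_simps)
      ultimately have "\<phi> t - \<phi> 0 \<le> t * (f y - f x - \<gamma> / 2 * (1 - t) * (norm (y - x))\<^sup>2)"
        by (simp add: \<phi>_def algebra_simps)
      then show ?thesis using that by (simp add: divide_le_eq mult.commute)
    qed
    then show "\<forall>\<^sub>F t in at 0 within {0..1}. (\<phi> t - \<phi> 0) / t
        \<le> f y - f x - \<gamma> / 2 * (1 - t) * (norm (y - x))\<^sup>2"
      by (auto simp: eventually_at_filter)
  qed
  then show ?thesis by simp
qed

text \<open>
  The descent lemma: along the segment, \<open>f\<close> minus the claimed quadratic majorant has a nonpositive
  derivative.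
\<close>
lemma lipschitz_gradient_upper_bound:
  assumes "gradient_on S f g" "convex S" "\<beta>-lipschitz_on S g" "x \<in> S" "y \<in> S"
  shows "f y \<le> f x + (y - x) \<bullet> g x + \<beta> / 2 * (norm (y - x))\<^sup>2"
proof -
  define l where "l t = x + t *\<^sub>R (y - x)" for t :: real
  have seg: "l t \<in> S" if "t \<in> {0..1}" for t
    using convexD_alt[of S x y t] assms(2,4,5) that by (simp add: l_def algebra_simps)
  define h where "h t = f (l t) - t * ((y - x) \<bullet> g x) - \<beta> / 2 * t\<^sup>2 * (norm (y - x))\<^sup>2" for t
  define h' where "h' t = (y - x) \<bullet> g (l t) - (y - x) \<bullet> g x - \<beta> * t * (norm (y - x))\<^sup>2" for t
  have fl: "((\<lambda>t. f (l t)) has_real_derivative (y - x) \<bullet> g (l t)) (at t within {0..1})"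
    if "t \<in> {0..1}" for t
    using gradient_on_segment[OF assms(1,2,4,5) that] by (simp add: l_def[abs_def])
  have dh: "(h has_real_derivative h' t) (at t within {0..1})" if "t \<in> {0..1}" for t
    unfolding h_def[abs_def] h'_def
    by (rule derivative_eq_intros fl[OF that] refl | simp)+
  have "\<exists>z\<in>{0<..<1}. h 1 - h 0 = (1 - 0) * h' z"
  proof -
    have "\<exists>z\<in>{0<..<1}. h 1 - h 0 = (\<lambda>s. s * h' z) (1 - 0)"
      using dh by (intro mvt_simple) (auto simp: has_field_derivative_def mult_commute_abs)
    then show ?thesis by simp
  qed
  then obtain z where z: "0 < z" "z < 1" "h 1 - h 0 = h' z" by auto
  have "(y - x) \<bullet> (g (l z) - g x) \<le> norm (y - x) * norm (g (l z) - g x)"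
    by (rule norm_cauchy_schwarz)
  also have "\<dots> \<le> norm (y - x) * (\<beta> * norm (l z - x))"
    using lipschitz_onD[OF assms(3), of "l z" x] seg[of z] z assms(4)
    by (intro mult_left_mono) (auto simp: dist_norm)
  also have "\<dots> = \<beta> * z * (norm (y - x))\<^sup>2"
    using z by (simp add: l_def power2_eq_square)
  finally have "h' z \<le> 0" by (simp add: h'_def inner_diff_right)
  then show ?thesis using z by (simp add: h_def l_def)
qed

text \<open>
  The quadratic lower and upper bounds sandwich \<open>f y\<close>, provided that there is a second point. This
  keeps the contraction factors nonnegative.
\<close>
lemma strong_convexity_le_smoothness:
  assumes "gradient_on S f g" "strongly_convex_on \<gamma> S f" "\<beta>-lipschitz_on S g"
    "x \<in> S" "y \<in> S" "x \<noteq> y"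
  shows "\<gamma> \<le> \<beta>"
proof -
  have "convex S" using assms(2) by (simp add: strongly_convex_on_def)
  from lipschitz_gradient_upper_bound[OF assms(1) this assms(3,4,5)]
    strongly_convex_first_order[OF assms(1,2,4,5)]
  have "\<gamma> * (norm (y - x))\<^sup>2 \<le> \<beta> * (norm (y - x))\<^sup>2" by simp
  then show ?thesis using assms(6) by (simp add: mult_le_cancel_right)
qed

section \<open>Gradient steps contract\<close>

text \<open>
  With \<open>F u = (norm u)\<^sup>2 / 2 - \<alpha> * f u\<close>, the right-hand side is the Bregman divergence
  \<open>F y - F x - (y - x) \<bullet> G x\<close> and \<open>G\<close> is the gradient of \<open>F\<close>. The upper bound on \<open>f\<close>
  with \<open>\<alpha> * \<beta> \<le> 1\<close> makes \<open>F\<close> lie above its tangent at \<open>x\<close>. Strong convexity of \<open>f\<close> puts \<open>F\<close> below its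
  tangent at \<open>y\<close> plus \<open>m / 2\<close> times the squared distance to \<open>y\<close>. Both bounds are compared at the point
  \<open>y - (1 / m) *\<^sub>R (G y - G x)\<close>, which minimises the difference of the two, and this point
  must belong to the domain.
\<close>
lemma gradient_step_bregman_bound:
  fixes g :: "'a::real_inner \<Rightarrow> 'a"
  assumes g: "gradient_on S f g" and sc: "strongly_convex_on \<gamma> S f" and lip: "\<beta>-lipschitz_on S g"
    and \<alpha>: "0 < \<alpha>" "\<alpha> * \<beta> \<le> 1" and m: "0 < m" "m = 1 - \<alpha> * \<gamma>"
    and xy: "x \<in> S" "y \<in> S"
    and G: "G = (\<lambda>x. x - \<alpha> *\<^sub>R g x)" and z: "y - (1 / m) *\<^sub>R (G y - G x) \<in> S"
  shows "(norm (G y - G x))\<^sup>2 / (2 * m)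
    \<le> (y - x) \<bullet> (y - x) / 2 - \<alpha> * (f y - f x - (y - x) \<bullet> g x)"
proof -
  have cS: "convex S" using sc by (simp add: strongly_convex_on_def)
  define w where "w = G y - G x"
  define z where "z = y - (1 / m) *\<^sub>R w"
  have zS: "z \<in> S" using z by (simp add: z_def w_def)
  have up: "f z \<le> f x + (z - x) \<bullet> g x + \<beta> / 2 * (norm (z - x))\<^sup>2"
    by (rule lipschitz_gradient_upper_bound[OF g cS lip xy(1) zS])
  have "\<alpha> * f z \<le> \<alpha> * (f x + (z - x) \<bullet> g x) + \<alpha> * \<beta> * ((norm (z - x))\<^sup>2 / 2)"
    using mult_left_mono[OF up, of \<alpha>] \<alpha> by (simp add: algebra_simps)
  also have "\<alpha> * \<beta> * ((norm (z - x))\<^sup>2 / 2) \<le> 1 * ((norm (z - x))\<^sup>2 / 2)"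
    using \<alpha> by (intro mult_right_mono) auto
  finally have 1: "\<alpha> * f z \<le> \<alpha> * (f x + (z - x) \<bullet> g x) + (z - x) \<bullet> (z - x) / 2"
    by (simp add: power2_norm_eq_inner)
  have "\<alpha> * (f y + (z - y) \<bullet> g y + \<gamma> / 2 * (norm (z - y))\<^sup>2) \<le> \<alpha> * f z"
    using strongly_convex_first_order[OF g sc xy(2) zS] \<alpha> by (intro mult_left_mono) auto
  moreover have "\<alpha> * (\<gamma> / 2 * (norm (z - y))\<^sup>2) = (1 - m) * ((z - y) \<bullet> (z - y)) / 2"
    using m by (simp add: power2_norm_eq_inner)
  ultimately have 2: "\<alpha> * f y + \<alpha> * ((z - y) \<bullet> g y) + (1 - m) * ((z - y) \<bullet> (z - y)) / 2 \<le> \<alpha> * f z"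
    unfolding distrib_left by linarith
  define e where "e = z - y"
  have ze: "z - x = (y - x) + e" "z - y = e" by (simp_all add: e_def)
  have "w = (y - x) - \<alpha> *\<^sub>R (g y - g x)" by (simp add: w_def G algebra_simps)
  then have we: "e \<bullet> w = e \<bullet> (y - x) - \<alpha> * (e \<bullet> g y) + \<alpha> * (e \<bullet> g x)"
    by (simp add: inner_diff_right right_diff_distrib)
  have ee: "m * (e \<bullet> e) = (w \<bullet> w) / m" "e \<bullet> w = - (w \<bullet> w) / m"
    using m(1) by (simp_all add: e_def z_def)
  have zg: "(z - x) \<bullet> g x = (y - x) \<bullet> g x + e \<bullet> g x"
    unfolding ze(1) by (rule inner_add_left)
  have zz: "(z - x) \<bullet> (z - x) = (y - x) \<bullet> (y - x) + 2 * (e \<bullet> (y - x)) + e \<bullet> e"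
    unfolding ze(1) by (simp only: inner_add_left inner_add_right inner_commute[of "y - x" e])
  have 3: "\<alpha> * f y + \<alpha> * (e \<bullet> g y) + (e \<bullet> e / 2 - m * (e \<bullet> e) / 2) \<le> \<alpha> * f z"
    using 2 by (simp add: ze(2) left_diff_distrib diff_divide_distrib)
  have linear: "0 \<le> D / 2 - (T - Q - R) + (E - W + U) + K / 2"
    if "P \<le> Q + (R + U) + (D + 2 * E + N) / 2" "T + W + (N / 2 - K / 2) \<le> P"
    for D E K N P Q R T U W :: real
    using that by (simp add: field_simps)
  from 1 3 have "0 \<le> (y - x) \<bullet> (y - x) / 2 - \<alpha> * (f y - f x - (y - x) \<bullet> g x) + e \<bullet> w + m * (e \<bullet> e) / 2"
    unfolding zg zz we distrib_left right_diff_distrib by (rule linear)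
  then have "w \<bullet> w / m / 2 \<le> (y - x) \<bullet> (y - x) / 2 - \<alpha> * (f y - f x - (y - x) \<bullet> g x)"
    unfolding ee by (simp add: field_simps)
  then show ?thesis by (simp add: w_def power2_norm_eq_inner mult.commute)
qed

text \<open>
  Adding the divergence bounds for \<open>(x, y)\<close> and \<open>(y, x)\<close> cancels the function values and leaves the
  co-coercivity \<open>(norm (G y - G x))\<^sup>2 / m \<le> (G y - G x) \<bullet> (y - x)\<close>; the Cauchy--Schwarz inequality
  turns it into a Lipschitz bound.
\<close>
lemma gradient_step_contracts_locally:
  fixes g :: "'a::real_inner \<Rightarrow> 'a"
  assumes g: "gradient_on S f g" and sc: "strongly_convex_on \<gamma> S f" and lip: "\<beta>-lipschitz_on S g"
    and \<alpha>: "0 < \<alpha>" "\<alpha> * \<beta> \<le> 1" and m: "0 < m" "m = 1 - \<alpha> * \<gamma>"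
    and xy: "x \<in> S" "y \<in> S"
    and G: "G = (\<lambda>x. x - \<alpha> *\<^sub>R g x)"
    and z: "y - (1 / m) *\<^sub>R (G y - G x) \<in> S" "x - (1 / m) *\<^sub>R (G x - G y) \<in> S"
  shows "norm (G y - G x) \<le> m * norm (y - x)"
proof -
  define w where "w = G y - G x"
  have eq: "w = (y - x) - \<alpha> *\<^sub>R (g y - g x)" by (simp add: w_def G algebra_simps)
  from gradient_step_bregman_bound[OF g sc lip \<alpha> m xy G z(1)]
    gradient_step_bregman_bound[OF g sc lip \<alpha> m xy(2,1) G z(2)]
  have "(norm w)\<^sup>2 / (2 * m) + (norm w)\<^sup>2 / (2 * m) \<le> (y - x) \<bullet> (y - x) / 2 + (x - y) \<bullet> (x - y) / 2
      + \<alpha> * ((y - x) \<bullet> g x) + \<alpha> * ((x - y) \<bullet> g y)"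
    unfolding w_def norm_minus_commute[of "G x" "G y"] right_diff_distrib by linarith
  also have "\<dots> = w \<bullet> (y - x)"
    unfolding eq by (simp add: inner_diff_left inner_diff_right algebra_simps inner_commute)
  also have "\<dots> \<le> norm w * norm (y - x)" by (rule norm_cauchy_schwarz)
  also have "(norm w)\<^sup>2 / (2 * m) + (norm w)\<^sup>2 / (2 * m) = norm w * (norm w / m)"
    by (simp add: power2_eq_square)
  finally have "norm w / m \<le> norm (y - x) \<or> w = 0"
    by (metis mult_le_cancel_left_pos norm_le_zero_iff not_le)
  then show ?thesis using m(1) by (auto simp: w_def divide_le_eq mult.commute)
qed

text \<open>
  Cut the segment into equal pieces of length at most \<open>\<delta>\<close> and add up: lengths along a segment are
  additive, so the constant \<open>m\<close> is preserved.
\<close>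
lemma norm_diff_le_of_local_on_segment:
  fixes G :: "'a::real_normed_vector \<Rightarrow> 'b::real_normed_vector"
  assumes "0 < \<delta>"
    and loc: "\<And>p q. p \<in> closed_segment x y \<Longrightarrow> q \<in> closed_segment x y \<Longrightarrow> norm (q - p) \<le> \<delta>
      \<Longrightarrow> norm (G q - G p) \<le> m * norm (q - p)"
  shows "norm (G y - G x) \<le> m * norm (y - x)"
proof -
  obtain N :: nat where N: "norm (y - x) / \<delta> < N" using reals_Archimedean2 by blast
  have "0 < real N" by (rule le_less_trans[OF _ N]) (use assms(1) in simp)
  then have N0: "N > 0" by simp
  define p where "p k = x + (real k / real N) *\<^sub>R (y - x)" for k
  have seg: "p k \<in> closed_segment x y" if "k \<le> N" for k
    using that N0 unfolding in_segment p_def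
    by (intro exI[of _ "real k / real N"]) (auto simp: algebra_simps)
  have step: "norm (p (Suc k) - p k) = norm (y - x) / N" for k
  proof -
    have "p (Suc k) - p k = (1 / real N) *\<^sub>R (y - x)"
      by (simp add: p_def algebra_simps add_divide_distrib flip: scaleR_left_diff_distrib)
    then show ?thesis by simp
  qed
  have small: "norm (y - x) / N \<le> \<delta>" using N assms(1) N0 by (simp add: field_simps)
  have "G y - G x = G (p N) - G (p 0)" using N0 by (simp add: p_def)
  also have "\<dots> = (\<Sum>k<N. G (p (Suc k)) - G (p k))" by (rule sum_lessThan_telescope[symmetric])
  also have "norm \<dots> \<le> (\<Sum>k<N. m * norm (p (Suc k) - p k))"
    using small by (intro sum_norm_le loc seg) (auto simp: step)
  also have "\<dots> = m * norm (y - x)" using N0 by (simp add: step)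
  finally show ?thesis .
qed

text \<open>
  The limiting form in which estimates away from the boundary are carried over to the whole domain.
\<close>
lemma le_of_le_add_scaled:
  fixes A B C :: real
  assumes "\<And>s. 0 < s \<Longrightarrow> s \<le> 1 \<Longrightarrow> A \<le> B + s * C"
  shows "A \<le> B"
proof -
  have "((\<lambda>s. B + s * C) \<longlongrightarrow> B + 0 * C) (at_right 0)" by (intro tendsto_intros)
  moreover have "\<forall>\<^sub>F s in at_right 0. A \<le> B + s * C"
    unfolding eventually_at_right_field by (rule exI[of _ 1]) (use assms in auto)
  ultimately have "A \<le> B + 0 * C" by (intro tendsto_lowerbound) auto
  then show ?thesis by simp
qed

text \<open>
  A nonempty convex set has a relative interior point, and the affine hull is the linear span
  because the set contains \<open>0\<close>.
\<close>
lemma obtain_relative_ball: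
  fixes S :: "'a::euclidean_space set"
  assumes "convex S" "0 \<in> S"
  obtains c r where "c \<in> S" "0 < r" "\<And>u. u \<in> span S \<Longrightarrow> norm u < r \<Longrightarrow> c + u \<in> S"
proof -
  obtain c where c: "c \<in> rel_interior S" using assms rel_interior_eq_empty[of S] by auto
  then obtain r where r: "r > 0" "c \<in> S" "ball c r \<inter> affine hull S \<subseteq> S"
    by (auto simp: mem_rel_interior_ball)
  have aff: "affine hull S = span S" using assms(2) by (simp add: affine_hull_span_0 hull_inc)
  have "c + u \<in> S" if "u \<in> span S" "norm u < r" for u
  proof -
    have "c + u \<in> span S" using that r(2) by (simp add: span_add span_base)
    then show ?thesis using r(3) that(2) by (auto simp: aff dist_norm subset_iff)
  qed
  then show ?thesis using that r by blast
qed

text \<open>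
  The homothety with centre \<open>c\<close> and ratio \<open>1 - s\<close> maps \<open>S\<close> to points that keep a margin \<open>s * r\<close>, uniform
  in \<open>x\<close>: the perturbed point is the convex combination of \<open>x\<close> and \<open>c + (1 / s) *\<^sub>R u\<close>.
\<close>
lemma relative_ball_shrink:
  assumes "convex S" "c \<in> S" "\<And>u. u \<in> span S \<Longrightarrow> norm u < r \<Longrightarrow> c + u \<in> S"
    and "x \<in> S" "0 < s" "s \<le> 1" "u \<in> span S" "norm u < s * r"
  shows "x + s *\<^sub>R (c - x) + u \<in> S"
proof -
  have "c + (1 / s) *\<^sub>R u \<in> S"
    using assms by (intro assms(3) span_scale) (auto simp: field_simps)
  then have "(1 - s) *\<^sub>R x + s *\<^sub>R (c + (1 / s) *\<^sub>R u) \<in> S"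
    using convexD_alt[OF assms(1,4)] assms by simp
  then show ?thesis using assms(5) by (simp add: algebra_simps)
qed

text \<open>
  Shrink \<open>S\<close> towards a relative interior point by a ratio \<open>1 - s\<close>. On the shrunk set the local
  contraction applies to pairs at distance at most \<open>\<delta>\<close>, hence to whole segments. Letting \<open>s\<close> tend to
  \<open>0\<close> costs nothing, since the step is \<open>2\<close>-Lipschitz by the crude triangle inequality. The gradient
  must be tangential so that the auxiliary points stay in the span of \<open>S\<close>.
\<close>
lemma tangential_gradient_step_contracts:
  fixes g :: "'a::euclidean_space \<Rightarrow> 'a"
  assumes S: "0 \<in> S"
    and g: "gradient_on S f g" and sc: "strongly_convex_on \<gamma> S f" and lip: "\<beta>-lipschitz_on S g"
    and tang: "\<And>x. x \<in> S \<Longrightarrow> g x \<in> span S"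
    and \<alpha>: "0 < \<alpha>" "\<alpha> * \<beta> \<le> 1" "\<alpha> * \<gamma> < 1"
    and xy: "x \<in> S" "y \<in> S"
  shows "norm ((y - \<alpha> *\<^sub>R g y) - (x - \<alpha> *\<^sub>R g x)) \<le> (1 - \<alpha> * \<gamma>) * norm (y - x)"
proof -
  have cS: "convex S" using sc by (simp add: strongly_convex_on_def)
  define m where "m = 1 - \<alpha> * \<gamma>"
  have m: "m > 0" using \<alpha> by (simp add: m_def)
  define G where "G = (\<lambda>x. x - \<alpha> *\<^sub>R g x)"
  have G2: "norm (G q - G p) \<le> 2 * norm (q - p)" if "p \<in> S" "q \<in> S" for p q
  proof -
    have "norm (G q - G p) = norm ((q - p) - \<alpha> *\<^sub>R (g q - g p))" by (simp add: G_def algebra_simps)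
    also have "\<dots> \<le> norm (q - p) + \<alpha> * norm (g q - g p)"
      using \<alpha>(1) norm_triangle_ineq4[of "q - p" "\<alpha> *\<^sub>R (g q - g p)"] by simp
    also have "\<alpha> * norm (g q - g p) \<le> \<alpha> * (\<beta> * norm (q - p))"
      using lipschitz_onD[OF lip that(2,1)] \<alpha>(1) by (intro mult_left_mono) (auto simp: dist_norm)
    also have "\<dots> \<le> 1 * norm (q - p)"
      using mult_right_mono[OF \<alpha>(2), of "norm (q - p)"] by (simp add: mult.assoc)
    finally show ?thesis by simp
  qed
  obtain c r where c: "c \<in> S" "0 < r" "\<And>u. u \<in> span S \<Longrightarrow> norm u < r \<Longrightarrow> c + u \<in> S"
    using obtain_relative_ball[OF cS S] by blast
  have "norm (G y - G x) \<le> m * norm (y - x) + s * (2 * norm (c - x) + 2 * norm (c - y))"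
    if s: "0 < s" "s \<le> 1" for s
  proof -
    define sh where "sh z = z + s *\<^sub>R (c - z)" for z
    have shS: "sh z \<in> S" if "z \<in> S" for z
      using convexD_alt[OF cS that c(1), of s] s by (simp add: sh_def algebra_simps)
    have shu: "sh z + u \<in> S" if "z \<in> S" "u \<in> span S" "norm u < s * r" for z u
      unfolding sh_def by (rule relative_ball_shrink[OF cS c(1,3)]) (use that s in auto)
    have img: "closed_segment (sh x) (sh y) \<subseteq> sh ` S"
    proof
      fix p assume "p \<in> closed_segment (sh x) (sh y)"
      then obtain t where t: "0 \<le> t" "t \<le> 1" "p = (1 - t) *\<^sub>R sh x + t *\<^sub>R sh y"
        by (auto simp: in_segment)
      have "p = sh ((1 - t) *\<^sub>R x + t *\<^sub>R y)" by (simp add: t sh_def algebra_simps)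
      moreover have "(1 - t) *\<^sub>R x + t *\<^sub>R y \<in> S" using convexD_alt[OF cS xy] t by simp
      ultimately show "p \<in> sh ` S" by blast
    qed
    \<comment> \<open>The auxiliary points are at distance at most \<open>2 * \<delta> / m\<close>, which is half the margin \<open>s * r\<close>.\<close>
    define \<delta> where "\<delta> = m * s * r / 4"
    have "norm (G (sh y) - G (sh x)) \<le> m * norm (sh y - sh x)"
    proof (rule norm_diff_le_of_local_on_segment[of \<delta>])
      show "0 < \<delta>" using m s c(2) by (simp add: \<delta>_def)
      fix p q assume pq: "p \<in> closed_segment (sh x) (sh y)" "q \<in> closed_segment (sh x) (sh y)"
        "norm (q - p) \<le> \<delta>"
      obtain p0 q0 where p0: "p0 \<in> S" "p = sh p0" and q0: "q0 \<in> S" "q = sh q0"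
        using pq(1,2) img by blast
      have pS: "p \<in> S" "q \<in> S" using p0 q0 shS by auto
      have sp: "G q - G p \<in> span S"
        using tang[OF pS(1)] tang[OF pS(2)] pS
        by (simp add: G_def span_diff span_scale span_base)
      have "norm (G q - G p) \<le> 2 * \<delta>" using G2[OF pS] pq(3) by simp
      also have "2 * \<delta> < m * (s * r)" using m s c(2) by (simp add: \<delta>_def)
      finally have "norm (G q - G p) < m * (s * r)" .
      then have sm: "norm ((1 / m) *\<^sub>R (G q - G p)) < s * r"
        using m by (simp add: divide_less_eq mult.commute del: scaleR_right_diff_distrib)
      have "q + - ((1 / m) *\<^sub>R (G q - G p)) \<in> S" unfolding q0(2)
        by (rule shu) (use q0 sp sm in \<open>auto intro!: span_neg span_scale\<close>)
      moreover have "p + (1 / m) *\<^sub>R (G q - G p) \<in> S" unfolding p0(2)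
        by (rule shu) (use p0 sp sm in \<open>auto intro!: span_scale\<close>)
      ultimately show "norm (G q - G p) \<le> m * norm (q - p)"
        by (intro gradient_step_contracts_locally[OF g sc lip \<alpha>(1,2) m m_def pS G_def])
          (simp_all add: algebra_simps)
    qed
    moreover have "norm (sh y - sh x) = (1 - s) * norm (y - x)"
    proof -
      have "sh y - sh x = (1 - s) *\<^sub>R (y - x)" by (simp add: sh_def algebra_simps)
      then show ?thesis using s by simp
    qed
    moreover have "m * ((1 - s) * norm (y - x)) \<le> m * norm (y - x)"
      using m s by (intro mult_left_mono mult_left_le_one_le) auto
    moreover have "norm (G y - G (sh y)) \<le> 2 * (s * norm (c - y))"
      using G2[OF shS[OF xy(2)] xy(2)] s by (simp add: sh_def)
    moreover have "norm (G (sh x) - G x) \<le> 2 * (s * norm (c - x))"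
      using G2[OF xy(1) shS[OF xy(1)]] s by (simp add: sh_def)
    moreover have "norm (G y - G x) \<le> norm (G y - G (sh y)) + norm (G (sh y) - G (sh x))
        + norm (G (sh x) - G x)"
      using norm_triangle_ineq[of "G y - G (sh y)" "G (sh y) - G (sh x)"]
        norm_triangle_ineq[of "G y - G (sh x)" "G (sh x) - G x"] by simp
    ultimately show ?thesis by (simp add: algebra_simps)
  qed
  then have "norm (G y - G x) \<le> m * norm (y - x)" by (rule le_of_le_add_scaled)
  then show ?thesis by (simp add: G_def m_def)
qed

text \<open>
  At a point \<open>p\<close> of the relative interior one may move a little in the direction of the gradient.
  Convexity makes \<open>f\<close> grow there at least at the rate \<open>norm (g p)\<close>, while the Lipschitz condition allows
  at most \<open>L\<close>. Boundary points follow by continuity of \<open>g\<close>.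
\<close>
lemma tangential_gradient_bound:
  fixes g :: "'a::euclidean_space \<Rightarrow> 'a"
  assumes S: "0 \<in> S"
    and g: "gradient_on S f g" and sc: "strongly_convex_on \<gamma> S f" "0 \<le> \<gamma>"
    and lip: "\<beta>-lipschitz_on S g" and Lip: "L-lipschitz_on S f"
    and tang: "\<And>x. x \<in> S \<Longrightarrow> g x \<in> span S"
    and x: "x \<in> S"
  shows "norm (g x) \<le> L"
proof -
  have cS: "convex S" using sc by (simp add: strongly_convex_on_def)
  obtain c r where c: "c \<in> S" "0 < r" "\<And>u. u \<in> span S \<Longrightarrow> norm u < r \<Longrightarrow> c + u \<in> S"
    using obtain_relative_ball[OF cS S] by blast
  have "norm (g x) \<le> L + s * (\<beta> * norm (c - x))" if s: "0 < s" "s \<le> 1" for s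
  proof -
    define p where "p = x + s *\<^sub>R (c - x)"
    have pS: "p \<in> S"
      using convexD_alt[OF cS x c(1), of s] s by (simp add: p_def algebra_simps)
    have "norm (g p) \<le> L"
    proof (cases "g p = 0")
      case True
      then show ?thesis using lipschitz_on_nonneg[OF Lip] by simp
    next
      case False
      define t where "t = s * r / (2 * norm (g p))"
      have t: "t > 0" using False s c(2) by (simp add: t_def)
      have "norm (t *\<^sub>R g p) < s * r" using False s c(2) by (simp add: t_def)
      then have qS: "p + t *\<^sub>R g p \<in> S" unfolding p_def
        by (intro relative_ball_shrink[OF cS c(1,3)])
          (use s x tang[OF pS] in \<open>auto simp: p_def intro!: span_scale\<close>)
      have "0 \<le> \<gamma> / 2 * (norm (t *\<^sub>R g p))\<^sup>2" using sc(2) by simp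
      then have "t * (g p \<bullet> g p) \<le> f (p + t *\<^sub>R g p) - f p"
        using strongly_convex_first_order[OF g sc(1) pS qS] by simp
      also have "\<dots> \<le> L * (t * norm (g p))"
        using lipschitz_onD[OF Lip qS pS] t by (simp add: dist_norm)
      finally have "(t * norm (g p)) * norm (g p) \<le> (t * norm (g p)) * L"
        by (simp add: power2_norm_eq_inner[symmetric] power2_eq_square mult_ac)
      then show ?thesis using t False by (simp add: mult_le_cancel_left)
    qed
    moreover have "norm (g x - g p) \<le> \<beta> * (s * norm (c - x))"
      using lipschitz_onD[OF lip x pS] s by (simp add: dist_norm p_def)
    ultimately show ?thesis using norm_triangle_sub[of "g x" "g p"] by (simp add: mult_ac)
  qed
  then show ?thesis by (rule le_of_le_add_scaled)
qed

text \<open>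
  Project orthogonally onto \<open>span S\<close>. Differences of points of \<open>S\<close> lie in the span, so the projection is
  still a gradient within \<open>S\<close>, and it is as Lipschitz as \<open>g\<close> because projections do not increase
  distances.
\<close>
lemma obtain_tangential_gradient:
  fixes g :: "'a::euclidean_space \<Rightarrow> 'a"
  assumes g: "gradient_on S f g" and lip: "\<beta>-lipschitz_on S g"
  obtains p where "gradient_on S f p" "\<beta>-lipschitz_on S p" "\<And>x. p x \<in> span S"
    "\<And>x. g x \<in> span S \<Longrightarrow> p x = g x"
proof -
  define P where "P = closest_point (span S)"
  have ne: "span S \<noteq> {}" using span_zero by blast
  have P: "P v \<in> span S" for v unfolding P_def by (rule closest_point_in_set[OF closed_span ne])
  have orth: "u \<bullet> P v = u \<bullet> v" if "u \<in> span S" for u v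
  proof -
    have "(v - P v) \<bullet> (w - P v) \<le> 0" if "w \<in> span S" for w
      unfolding P_def using that
      by (intro closest_point_dot) (auto simp: closed_span subspace_imp_convex)
    \<comment> \<open>In a subspace both directions \<open>u\<close> and \<open>- u\<close> are admissible, so the obtuse-angle inequality
      becomes an equality.\<close>
    from this[of "P v + u"] this[of "P v - u"] show ?thesis
      using P[of v] that by (simp add: span_add span_diff inner_diff_right inner_commute)
  qed
  have "gradient_on S f (\<lambda>x. P (g x))"
    unfolding gradient_on_def
  proof
    fix x assume x: "x \<in> S"
    have "(f has_derivative (\<lambda>h. h \<bullet> g x)) (at x within S)"
      using g x by (simp add: gradient_on_def)
    moreover have "(y - x) \<bullet> g x = (y - x) \<bullet> P (g x)" if "y \<in> S" for y
      using orth[of "y - x" "g x"] that x by (simp add: span_diff span_base)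
    ultimately show "(f has_derivative (\<lambda>h. h \<bullet> P (g x))) (at x within S)"
      by (auto simp: has_derivative_within' bounded_linear_inner_left)
  qed
  moreover have "\<beta>-lipschitz_on S (\<lambda>x. P (g x))"
  proof (rule lipschitz_onI)
    show "0 \<le> \<beta>" using lip by (rule lipschitz_on_nonneg)
    fix x y assume "x \<in> S" "y \<in> S"
    have "dist (P (g x)) (P (g y)) \<le> dist (g x) (g y)"
      unfolding P_def using closest_point_lipschitz[OF _ closed_span ne]
      by (simp add: subspace_imp_convex)
    also have "\<dots> \<le> \<beta> * dist x y" using lip \<open>x \<in> S\<close> \<open>y \<in> S\<close> by (rule lipschitz_onD)
    finally show "dist (P (g x)) (P (g y)) \<le> \<beta> * dist x y" .
  qed
  moreover have "P (g x) = g x" if "g x \<in> span S" for x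
    using that by (simp add: P_def closest_point_self)
  ultimately show ?thesis using that P by blast
qed

lemma feasible_step_in_span:
  assumes "x \<in> S" "x - \<alpha> *\<^sub>R v \<in> S" "\<alpha> \<noteq> 0"
  shows "v \<in> span S"
proof -
  have "(1 / \<alpha>) *\<^sub>R (x - (x - \<alpha> *\<^sub>R v)) \<in> span S"
    using assms(1,2) by (intro span_scale span_diff span_base)
  then show ?thesis using assms(3) by simp
qed

lemma feasible_gradient_step_contracts:
  fixes g :: "'a::euclidean_space \<Rightarrow> 'a"
  assumes S: "0 \<in> S"
    and g: "gradient_on S f g" and sc: "strongly_convex_on \<gamma> S f" and lip: "\<beta>-lipschitz_on S g"
    and \<alpha>: "0 < \<alpha>" "\<alpha> * \<beta> \<le> 1" "\<alpha> * \<gamma> < 1"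
    and x: "x \<in> S" "x - \<alpha> *\<^sub>R g x \<in> S" and y: "y \<in> S" "y - \<alpha> *\<^sub>R g y \<in> S"
  shows "norm ((y - \<alpha> *\<^sub>R g y) - (x - \<alpha> *\<^sub>R g x)) \<le> (1 - \<alpha> * \<gamma>) * norm (y - x)"
proof -
  obtain p where p: "gradient_on S f p" "\<beta>-lipschitz_on S p" "\<And>x. p x \<in> span S"
    "\<And>x. g x \<in> span S \<Longrightarrow> p x = g x"
    using obtain_tangential_gradient[OF g lip] by blast
  have "p x = g x" "p y = g y"
    using feasible_step_in_span[OF x] feasible_step_in_span[OF y] \<alpha>(1) p(4) by auto
  then show ?thesis
    using tangential_gradient_step_contracts[OF S p(1) sc p(2,3) \<alpha> x(1) y(1)] by simp
qed

lemma feasible_gradient_bound: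
  fixes g :: "'a::euclidean_space \<Rightarrow> 'a"
  assumes S: "0 \<in> S"
    and g: "gradient_on S f g" and sc: "strongly_convex_on \<gamma> S f" "0 \<le> \<gamma>"
    and lip: "\<beta>-lipschitz_on S g" and Lip: "L-lipschitz_on S f"
    and x: "x \<in> S" "x - \<alpha> *\<^sub>R g x \<in> S" "\<alpha> \<noteq> 0"
  shows "norm (g x) \<le> L"
proof -
  obtain p where p: "gradient_on S f p" "\<beta>-lipschitz_on S p" "\<And>x. p x \<in> span S"
    "\<And>x. g x \<in> span S \<Longrightarrow> p x = g x"
    using obtain_tangential_gradient[OF g lip] by blast
  have "p x = g x" using feasible_step_in_span[OF x] by (rule p(4))
  then show ?thesis
    using tangential_gradient_bound[OF S p(1) sc p(2) Lip p(3) x(1)] by simp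
qed

section \<open>The product of contraction factors\<close>

text \<open>
  The first diagonal Pade approximant \<open>(2 + u) / (2 - u)\<close> dominates \<open>exp\<close> on \<open>[0, 2)\<close>; cleared of its
  denominator the inequality holds for all \<open>u \<ge> 0\<close>.
\<close>
lemma exp_le_pade:
  fixes u :: real
  assumes "0 \<le> u"
  shows "exp u * (2 - u) \<le> 2 + u"
proof -
  define h where "h u = 2 + u - exp u * (2 - u)" for u :: real
  have "h 0 \<le> h u"
  proof (rule DERIV_nonneg_imp_nondecreasing[OF assms])
    fix t :: real assume "0 \<le> t" "t \<le> u"
    have "(h has_real_derivative 1 - exp t * (1 - t)) (at t)"
      unfolding h_def[abs_def] by (auto intro!: derivative_eq_intros simp: algebra_simps)
    moreover have "exp t * (1 - t) \<le> 1"
    proof -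
      have "1 - t \<le> exp (- t)" using exp_ge_add_one_self[of "- t"] by simp
      then have "exp t * (1 - t) \<le> exp t * exp (- t)" by (intro mult_left_mono) auto
      then show ?thesis by (simp add: exp_minus)
    qed
    ultimately show "\<exists>y. (h has_real_derivative y) (at t) \<and> 0 \<le> y" by force
  qed
  then show ?thesis by (simp add: h_def)
qed

text \<open>
  Since \<open>exp (u + v) - 1 = p + q + p * q\<close> for \<open>p = exp u - 1\<close> and \<open>q = exp v - 1\<close>, division by
  \<open>u * v * p * q\<close> separates the variables: the claim becomes \<open>1 / u + 1 / v \<le> 1 / p + 1 / q + 1\<close>,
  and \<open>1 / u \<le> 1 / p + 1 / 2\<close> is the Pade bound.
\<close>
lemma expm1_product_le:
  fixes u v :: real
  assumes "0 < u" "0 < v"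
  shows "(u + v) * ((exp u - 1) * (exp v - 1)) \<le> u * v * (exp (u + v) - 1)"
proof -
  have *: "1 / w \<le> 1 / (exp w - 1) + 1 / 2" if "w > 0" for w :: real
    using exp_le_pade[of w] that by (simp add: field_simps)
  define p q where "p = exp u - 1" "q = exp v - 1"
  have pq: "p > 0" "q > 0" using assms by (auto simp: p_q_def)
  have "1 / u + 1 / v \<le> 1 / p + 1 / q + 1"
    using *[OF assms(1)] *[OF assms(2)] by (simp add: p_q_def)
  then have "(1 / u + 1 / v) * (u * v * (p * q)) \<le> (1 / p + 1 / q + 1) * (u * v * (p * q))"
    using assms pq by (intro mult_right_mono) auto
  moreover have "(1 / u + 1 / v) * (u * v * (p * q)) = (u + v) * (p * q)"
    using assms by (simp add: field_simps)
  moreover have "(1 / p + 1 / q + 1) * (u * v * (p * q)) = u * v * (p + q + p * q)"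
    using pq by (simp add: field_simps)
  moreover have "p + q + p * q = exp (u + v) - 1" by (simp add: p_q_def exp_add algebra_simps)
  ultimately have "(u + v) * (p * q) \<le> u * v * (exp (u + v) - 1)" by (simp only:)
  then show ?thesis by (simp add: p_q_def)
qed

text \<open>
  This is the bound on the contraction factors for \<open>n = 2\<close>. It is an equality at both ends of the
  interval of \<open>a\<close> and nearly one in the middle, so a cruder estimate of the exponentials would not do.
\<close>
lemma two_powr_product_le:
  fixes a :: real
  assumes "0 < a" "a < 1"
  shows "(2 powr a - 1) * (2 powr (1 - a) - 1) \<le> a * (1 - a) * ln 2"
proof -
  let ?u = "a * ln 2" and ?v = "(1 - a) * ln (2::real)"
  have s: "?u + ?v = ln 2" by (simp add: algebra_simps)
  have "ln 2 * ((2 powr a - 1) * (2 powr (1 - a) - 1)) \<le> ?u * ?v * (2 - 1)"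
    using expm1_product_le[of ?u ?v] assms unfolding s by (simp add: powr_def)
  then have "ln 2 * ((2 powr a - 1) * (2 powr (1 - a) - 1)) \<le> ln 2 * (a * (1 - a) * ln 2)"
    by (simp add: algebra_simps)
  then show ?thesis by (subst (asm) mult_le_cancel_left_pos) auto
qed

lemma powr_diff_mvt:
  fixes b x :: real
  assumes "0 < x"
  obtains z where "x < z" "z < x + 1" "(x + 1) powr b - x powr b = b * z powr (b - 1)"
proof -
  have "\<exists>z>x. z < x + 1 \<and> (x + 1) powr b - x powr b = (x + 1 - x) * (b * z powr (b - 1))"
    using assms by (intro MVT2) (auto intro!: derivative_eq_intros)
  then show ?thesis using that by auto
qed

text \<open>
  The left-hand side is the integral of \<open>t powr (- a)\<close> over \<open>[x, x + 1]\<close>.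
\<close>
lemma powr_increment_le:
  fixes a x :: real
  assumes "0 \<le> a" "a < 1" "0 < x"
  shows "((x + 1) powr (1 - a) - x powr (1 - a)) / (1 - a) \<le> x powr (- a)"
proof -
  obtain z where z: "x < z" "z < x + 1"
    "(x + 1) powr (1 - a) - x powr (1 - a) = (1 - a) * z powr (1 - a - 1)"
    using powr_diff_mvt[OF assms(3)] by blast
  have "z powr (- a) \<le> x powr (- a)" using z assms by (intro powr_mono2') auto
  then show ?thesis using z(3) assms by simp
qed

text \<open>
  Concavity of \<open>t \<mapsto> t powr a\<close>. These increments are the thresholds that \<open>\<kappa>\<close> has to reach in
  \<open>factor_le_ratio_iff\<close>.
\<close>
lemma powr_increment_antimono:
  fixes a :: real
  assumes "0 < a" "a < 1" "1 \<le> s" "s \<le> (t::nat)"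
  shows "real t powr a - (real t - 1) powr a \<le> real s powr a - (real s - 1) powr a"
  using assms(4)
proof (induction t rule: dec_induct)
  case (step t)
  have t1: "1 \<le> t" using step assms by simp
  have "real (Suc t) powr a - real t powr a \<le> real t powr a - (real t - 1) powr a"
  proof (cases "t = 1")
    \<comment> \<open>The mean value theorem is not applied at the base point \<open>0\<close>, where \<open>powr\<close> is not
      differentiable.\<close>
    case True
    have "2 powr a \<le> 2 powr (1::real)" using assms by (intro powr_mono) auto
    then show ?thesis using True by simp
  next
    case False
    then have "0 < real t - 1" "0 < real t" using t1 by auto
    obtain z where z: "real t < z" "(real t + 1) powr a - real t powr a = a * z powr (a - 1)"
      using powr_diff_mvt[OF \<open>0 < real t\<close>] by blast
    obtain w where w: "real t - 1 < w" "w < real t - 1 + 1"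
      "(real t - 1 + 1) powr a - (real t - 1) powr a = a * w powr (a - 1)"
      using powr_diff_mvt[OF \<open>0 < real t - 1\<close>] by blast
    have "z powr (a - 1) \<le> w powr (a - 1)"
      using z w assms \<open>0 < real t - 1\<close> by (intro powr_mono2') auto
    then show ?thesis using z(2) w(3) assms by (simp add: add.commute)
  qed
  then show ?case using step.IH by simp
qed simp

lemma sum_powr_neg_ge:
  fixes a :: real
  assumes "0 \<le> a" "a < 1" "1 \<le> n"
  shows "((real n + 1) powr (1 - a) - 2 powr (1 - a)) / (1 - a) \<le> (\<Sum>t\<in>{1<..n}. real t powr (- a))"
  using assms(3)
proof (induction n rule: dec_induct)
  case (step n)
  have "{1<..Suc n} = insert (Suc n) {1<..n}" using step by auto
  then have "(\<Sum>t\<in>{1<..Suc n}. real t powr (- a)) = real (Suc n) powr (- a) + (\<Sum>t\<in>{1<..n}. real t powr (- a))"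
    by simp
  moreover have "((real (Suc n) + 1) powr (1 - a) - real (Suc n) powr (1 - a)) / (1 - a) \<le> real (Suc n) powr (- a)"
    using assms by (intro powr_increment_le) auto
  moreover have "((real (Suc n) + 1) powr (1 - a) - 2 powr (1 - a)) / (1 - a)
    = ((real (Suc n) + 1) powr (1 - a) - real (Suc n) powr (1 - a)) / (1 - a)
     + ((real n + 1) powr (1 - a) - 2 powr (1 - a)) / (1 - a)"
    by (simp add: diff_divide_distrib add.commute)
  ultimately show ?case using step.IH by linarith
qed simp

lemma factor_nonneg:
  fixes a \<kappa> :: real
  assumes "0 < a" "0 \<le> \<kappa>" "\<kappa> \<le> 1" "1 \<le> (t::nat)"
  shows "0 \<le> 1 - \<kappa> * real t powr (- a)"
proof -
  have "real t powr (- a) \<le> real t powr 0" using assms by (intro powr_mono) auto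
  then have "\<kappa> * real t powr (- a) \<le> 1 * 1" using assms by (intro mult_mono) auto
  then show ?thesis by simp
qed

text \<open>
  For \<open>n \<ge> 3\<close>, \<open>2 \<le> (n + 1) / 2\<close> lets the integral over \<open>[2, n + 1]\<close> be bounded below by
  \<open>n powr (1 - a) * (1 - 2 powr (- (1 - a))) / (1 - a)\<close>, and the constant in the hypothesis
  on \<open>\<kappa>\<close> is chosen so that \<open>\<kappa>\<close> times this is at least \<open>a * ln n\<close>. For \<open>n = 2\<close> this range of integration
  is too short; the claim there is \<open>2 powr a - 1 \<le> \<kappa>\<close>.
\<close>
lemma factor_product_from_one:
  fixes a \<kappa> :: real
  assumes a: "0 < a" "a < 1" and \<kappa>: "0 \<le> \<kappa>" "\<kappa> \<le> 1" and n: "1 \<le> n"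
    and big: "a * (1 - a) / (1 - 2 powr (- (1 - a))) * (ln (real n) / real n powr (1 - a)) \<le> \<kappa>"
  shows "(\<Prod>t\<in>{1<..n}. 1 - \<kappa> * real t powr (- a)) \<le> real n powr (- a)"
proof -
  define b where "b = 1 - a"
  have b: "0 < b" "b < 1" using a by (auto simp: b_def)
  have c0: "2 powr (- b) < 1" using b powr_less_mono[of "-b" 0 2] by simp
  consider "n = 1" | "n = 2" | "3 \<le> n" using n by linarith
  then show ?thesis
  proof cases
    case 1
    then show ?thesis by simp
  next
    case 2
    have e: "(1 - 2 powr (- b)) * 2 powr b = 2 powr b - 1"
      by (simp add: left_diff_distrib flip: powr_add)
    have "2 powr b > 1" using b powr_less_mono[of 0 b 2] by simp
    have "a * b / (1 - 2 powr (- b)) * (ln 2 / 2 powr b) \<le> \<kappa>"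
      using big 2 by (simp add: b_def)
    then have "a * b * ln 2 / (2 powr b - 1) \<le> \<kappa>"
      unfolding e[symmetric] by simp
    moreover have "2 powr a - 1 \<le> a * b * ln 2 / (2 powr b - 1)"
      using two_powr_product_le[OF a] \<open>2 powr b > 1\<close> by (simp add: b_def[symmetric] pos_le_divide_eq)
    ultimately have "(2 powr a - 1) * 2 powr (- a) \<le> \<kappa> * 2 powr (- a)"
      by (intro mult_right_mono) auto
    moreover have "(2 powr a - 1) * 2 powr (- a) = 1 - 2 powr (- a)"
      by (simp add: left_diff_distrib flip: powr_add)
    moreover have "{1<..2::nat} = {2}" by auto
    ultimately show ?thesis using 2 by simp
  next
    case 3
    define \<Sigma> where "\<Sigma> = (\<Sum>t\<in>{1<..n}. real t powr (- a))"
    have "((real n + 1) / 2) powr b \<ge> 2 powr b" using 3 b by (intro powr_mono2) auto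
    moreover have "((real n + 1) / 2) powr b = (real n + 1) powr b * 2 powr (- b)"
      by (simp add: powr_divide powr_minus_divide)
    moreover have "real n powr b * (1 - 2 powr (- b)) \<le> (real n + 1) powr b * (1 - 2 powr (- b))"
      using b c0 by (intro mult_right_mono powr_mono2) auto
    ultimately have "real n powr b * (1 - 2 powr (- b)) \<le> (real n + 1) powr b - 2 powr b"
      by (simp add: algebra_simps)
    then have "real n powr b * (1 - 2 powr (- b)) / b \<le> ((real n + 1) powr b - 2 powr b) / b"
      using b by (simp add: divide_right_mono)
    also have "\<dots> \<le> \<Sigma>" using sum_powr_neg_ge[of a n] a n by (simp add: b_def \<Sigma>_def)
    finally have S: "real n powr b * (1 - 2 powr (- b)) / b \<le> \<Sigma>" .
    have "a * ln n = (a * b / (1 - 2 powr (- b)) * (ln (real n) / real n powr b))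
        * (real n powr b * (1 - 2 powr (- b)) / b)"
    proof -
      have "1 - 2 powr (- b) \<noteq> 0" "real n powr b \<noteq> 0" "b \<noteq> 0" using b c0 3 by auto
      then show ?thesis by simp
    qed
    also have "\<dots> \<le> \<kappa> * \<Sigma>"
      using S big b c0 \<kappa> by (intro mult_mono) (auto simp: b_def)
    finally have aln: "a * ln n \<le> \<kappa> * \<Sigma>" .
    have "(\<Prod>t\<in>{1<..n}. 1 - \<kappa> * real t powr (- a)) \<le> (\<Prod>t\<in>{1<..n}. exp (- (\<kappa> * real t powr (- a))))"
    proof (intro prod_mono conjI)
      fix t assume "t \<in> {1<..n}"
      then show "0 \<le> 1 - \<kappa> * real t powr (- a)" using a \<kappa> by (intro factor_nonneg) auto
      show "1 - \<kappa> * real t powr (- a) \<le> exp (- (\<kappa> * real t powr (- a)))"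
        using exp_ge_add_one_self[of "- (\<kappa> * real t powr (- a))"] by simp
    qed
    also have "\<dots> = exp (- (\<kappa> * \<Sigma>))"
      by (simp add: \<Sigma>_def exp_sum[symmetric] sum_negf sum_distrib_left)
    also have "\<dots> \<le> exp (- (a * ln n))" using aln by simp
    also have "\<dots> = real n powr (- a)" using 3 by (simp add: powr_def)
    finally show ?thesis .
  qed
qed

text \<open>
  The quotients \<open>((t - 1) / t) powr a\<close> are the factors for which the product telescopes.
\<close>
lemma factor_le_ratio_iff:
  fixes a \<kappa> :: real
  assumes "1 \<le> (t::nat)"
  shows "1 - \<kappa> * real t powr (- a) \<le> (real t - 1) powr a * real t powr (- a)
    \<longleftrightarrow> real t powr a - (real t - 1) powr a \<le> \<kappa>"
proof -
  have "real t powr a * real t powr (- a) = 1" using assms by (simp flip: powr_add)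
  then have "1 - \<kappa> * real t powr (- a) \<le> (real t - 1) powr a * real t powr (- a)
    \<longleftrightarrow> (real t powr a - (real t - 1) powr a) * real t powr (- a) \<le> \<kappa> * real t powr (- a)"
    by (auto simp: algebra_simps)
  also have "\<dots> \<longleftrightarrow> real t powr a - (real t - 1) powr a \<le> \<kappa>"
    using assms by (intro mult_le_cancel_right_pos) simp
  finally show ?thesis .
qed

text \<open>
  The increments \<open>t powr a - (t - 1) powr a\<close> decrease in \<open>t\<close>, so comparing \<open>\<kappa>\<close> with the one at
  \<open>t = Suc i\<close> decides the comparison with the telescoping factors for all later indices, or for all earlier ones. In the second case
  the factors up to \<open>i\<close> exceed the telescoping ones, and the claim follows from the case \<open>i = 1\<close>.
\<close>
lemma factor_product_from:
  fixes a \<kappa> :: real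
  assumes a: "0 < a" "a < 1" and \<kappa>: "0 \<le> \<kappa>" "\<kappa> \<le> 1" and i: "1 \<le> i" "i \<le> n"
    and big: "a * (1 - a) / (1 - 2 powr (- (1 - a))) * (ln (real n) / real n powr (1 - a)) \<le> \<kappa>"
  shows "real i powr (- a) * (\<Prod>t\<in>{i<..n}. 1 - \<kappa> * real t powr (- a)) \<le> real n powr (- a)"
proof -
  let ?f = "\<lambda>t::nat. 1 - \<kappa> * real t powr (- a)"
  let ?u = "\<lambda>t::nat. real t powr a - (real t - 1) powr a"
  have f0: "0 \<le> ?f t" if "1 \<le> t" for t using factor_nonneg[OF a(1) \<kappa> that] .
  have split: "{l<..Suc m} = insert (Suc m) {l<..m}" if "l \<le> m" for l m :: nat
    using that by auto
  show ?thesis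
  proof (cases "?u (Suc i) \<le> \<kappa>")
    case True
    show ?thesis using i(2)
    proof (induction n rule: dec_induct)
      case (step m)
      have "?u (Suc m) \<le> \<kappa>"
        using powr_increment_antimono[OF a, of "Suc i" "Suc m"] step True by simp
      then have "?f (Suc m) \<le> (real (Suc m) - 1) powr a * real (Suc m) powr (- a)"
        by (subst factor_le_ratio_iff) auto
      then have fm: "?f (Suc m) \<le> real m powr a * real (Suc m) powr (- a)" by simp
      have "real i powr (- a) * (\<Prod>t\<in>{i<..Suc m}. ?f t)
        = (real i powr (- a) * (\<Prod>t\<in>{i<..m}. ?f t)) * ?f (Suc m)"
        using step by (simp add: split)
      also have "\<dots> \<le> real m powr (- a) * ?f (Suc m)"
        using step f0[of "Suc m"] by (intro mult_right_mono) auto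
      also have "\<dots> \<le> real m powr (- a) * (real m powr a * real (Suc m) powr (- a))"
        using fm by (intro mult_left_mono) auto
      also have "\<dots> = real (Suc m) powr (- a)"
        using step i by (simp add: mult.assoc[symmetric] flip: powr_add)
      finally show ?case .
    qed simp
  next
    case False
    have low: "real j powr (- a) \<le> (\<Prod>t\<in>{1<..j}. ?f t)" if "1 \<le> j" "j \<le> i" for j
      using that
    proof (induction j rule: dec_induct)
      case (step m)
      have "?u (Suc i) \<le> ?u (Suc m)"
        using powr_increment_antimono[OF a, of "Suc m" "Suc i"] step by simp
      then have "\<not> ?u (Suc m) \<le> \<kappa>" using False by simp
      then have "\<not> ?f (Suc m) \<le> (real (Suc m) - 1) powr a * real (Suc m) powr (- a)"
        by (subst factor_le_ratio_iff) auto
      then have fm: "real m powr a * real (Suc m) powr (- a) \<le> ?f (Suc m)" by simp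
      have "real (Suc m) powr (- a) = real m powr (- a) * (real m powr a * real (Suc m) powr (- a))"
        using step i by (simp add: mult.assoc[symmetric] flip: powr_add)
      also have "\<dots> \<le> (\<Prod>t\<in>{1<..m}. ?f t) * ?f (Suc m)"
        using fm step by (intro mult_mono prod_nonneg ballI f0) auto
      also have "\<dots> = (\<Prod>t\<in>{1<..Suc m}. ?f t)" using step by (simp add: split)
      finally show ?case .
    qed simp
    have "real i powr (- a) * (\<Prod>t\<in>{i<..n}. ?f t) \<le> (\<Prod>t\<in>{1<..i}. ?f t) * (\<Prod>t\<in>{i<..n}. ?f t)"
      using low[OF i(1)] i by (intro mult_right_mono prod_nonneg ballI f0) auto
    also have "\<dots> = (\<Prod>t\<in>{1<..i} \<union> {i<..n}. ?f t)"
      by (rule prod.union_disjoint[symmetric]) auto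
    also have "{1<..i} \<union> {i<..n} = {1<..n}" using i by auto
    also have "(\<Prod>t\<in>{1<..n}. ?f t) \<le> real n powr (- a)"
      using i by (intro factor_product_from_one[OF a \<kappa> _ big]) auto
    finally show ?thesis .
  qed
qed

section \<open>Stability of the iteration\<close>

lemma sgd_cong:
  assumes "\<And>s. s \<in> {1..t} \<Longrightarrow> X s = Y s"
  shows "sgd g \<alpha> X t = sgd g \<alpha> Y t"
  using assms by (induction t) auto

theorem proposition5p1:
  fixes \<Theta> :: "'a::euclidean_space set"
    and \<X> :: "'x set"
    and \<psi> :: "'a \<Rightarrow> 'x \<Rightarrow> real"
    and \<psi>' :: "'a \<Rightarrow> 'x \<Rightarrow> 'a"
    and \<gamma> \<beta> L a :: real
    and \<alpha> :: "nat \<Rightarrow> real"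
    and n i :: nat
    and X :: "nat \<Rightarrow> 'x"
    and x' :: 'x
  assumes "convex \<Theta>" and "0 \<in> \<Theta>"
    and "\<gamma> > 0" and "\<beta> > 0" and "L > 0"
    and "\<And>x. x \<in> \<X> \<Longrightarrow> gradient_on \<Theta> (\<lambda>\<theta>. \<psi> \<theta> x) (\<lambda>\<theta>. \<psi>' \<theta> x)"
    and "\<And>x. x \<in> \<X> \<Longrightarrow> strongly_convex_on \<gamma> \<Theta> (\<lambda>\<theta>. \<psi> \<theta> x)"
    and "\<And>x. x \<in> \<X> \<Longrightarrow> L-lipschitz_on \<Theta> (\<lambda>\<theta>. \<psi> \<theta> x)"
    and "\<And>x. x \<in> \<X> \<Longrightarrow> \<beta>-lipschitz_on \<Theta> (\<lambda>\<theta>. \<psi>' \<theta> x)"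
    and "0 < a" and "a < 1"
    and "\<And>t. t \<in> {1..n} \<Longrightarrow> \<alpha> t = real t powr (- a) * inverse \<beta>"
    and "\<gamma> / \<beta> \<ge> a * (1 - a) / (1 - 2 powr (- (1 - a))) * (ln (real n) / real n powr (1 - a))"
    and "i \<in> {1..n}"
    and "\<And>t. t \<in> {1..n} \<Longrightarrow> X t \<in> \<X>" and "x' \<in> \<X>"
    and "\<And>t. t \<le> n \<Longrightarrow> sgd \<psi>' \<alpha> X t \<in> \<Theta>"
    and "\<And>t. t \<le> n \<Longrightarrow> sgd \<psi>' \<alpha> (X(i := x')) t \<in> \<Theta>"
  shows "norm (nabla i x' (\<lambda>Y. sgd \<psi>' \<alpha> Y n) X) \<le> 2 * L / \<beta> * real n powr (- a)"
proof -
  note S0 = assms(2) and g = assms(6) and sc = assms(7) and Lip = assms(8)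
    and lip = assms(9) and a = assms(10,11) and step = assms(12) and big = assms(13) and i = assms(14)
  note XX = assms(15,16) and feasX = assms(17) and feasY = assms(18)
  define Y where "Y = X(i := x')"
  define A where "A t = sgd \<psi>' \<alpha> X t" for t
  define B where "B t = sgd \<psi>' \<alpha> Y t" for t
  define \<kappa> where "\<kappa> = \<gamma> / \<beta>"
  have A: "A (Suc t) = A t - \<alpha> (Suc t) *\<^sub>R \<psi>' (A t) (X (Suc t))"
    and B: "B (Suc t) = B t - \<alpha> (Suc t) *\<^sub>R \<psi>' (B t) (Y (Suc t))" for t
    by (simp_all add: A_def B_def)
  have AS: "A t \<in> \<Theta>" and BS: "B t \<in> \<Theta>" if "t \<le> n" for t
    using feasX[OF that] feasY[OF that] by (simp_all add: A_def B_def Y_def)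
  have Yi: "Y i = x'" and Yt: "\<And>t. t \<noteq> i \<Longrightarrow> Y t = X t" by (auto simp: Y_def)
  have apos: "\<alpha> t > 0" if "t \<in> {1..n}" for t
    using step[OF that] assms(4) that by simp
  have start: "norm (A i - B i) \<le> 2 * L / \<beta> * real i powr (- a)"
  proof -
    obtain k where k: "i = Suc k" using i by (cases i) auto
    have eq: "A k = B k" unfolding A_def B_def by (rule sgd_cong) (auto simp: Yt k)
    have "A k \<in> \<Theta>" "A i \<in> \<Theta>" "B k \<in> \<Theta>" "B i \<in> \<Theta>" using AS BS i k by auto
    then have "norm (\<psi>' (A k) (X i)) \<le> L" "norm (\<psi>' (A k) x') \<le> L"
      using feasible_gradient_bound[OF S0 g sc _ lip Lip, of "X i" "A k" "\<alpha> i"]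
        feasible_gradient_bound[OF S0 g sc _ lip Lip, of x' "B k" "\<alpha> i"]
        XX(1)[OF i] XX(2) apos[OF i] assms(3) A[of k] B[of k] eq Yi by (auto simp: k[symmetric])
    then have "norm (\<psi>' (A k) x' - \<psi>' (A k) (X i)) \<le> 2 * L"
      using norm_triangle_ineq4[of "\<psi>' (A k) x'" "\<psi>' (A k) (X i)"] by simp
    moreover have "A i - B i = \<alpha> i *\<^sub>R (\<psi>' (A k) x' - \<psi>' (A k) (X i))"
      using A[of k] B[of k] eq Yi by (simp add: k[symmetric] algebra_simps)
    ultimately have "norm (A i - B i) \<le> \<alpha> i * (2 * L)"
      using apos[OF i] by simp
    then show ?thesis using step[OF i] by (simp add: divide_inverse mult_ac)
  qed
  show ?thesis
  proof (cases "A n = B n")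
    case True
    then show ?thesis using assms(4,5) by (simp add: nabla_def A_def B_def Y_def)
  next
    case False
    \<comment> \<open>Distinct end points provide the two points of \<open>\<Theta>\<close> that force \<open>\<gamma> \<le> \<beta>\<close>.\<close>
    have "\<gamma> \<le> \<beta>"
      using strong_convexity_le_smoothness[OF g sc lip] XX(2) AS[of n] BS[of n] False by blast
    then have \<kappa>: "0 \<le> \<kappa>" "\<kappa> \<le> 1" using assms(3,4) by (auto simp: \<kappa>_def)
    have contr: "norm (A (Suc t) - B (Suc t)) \<le> (1 - \<kappa> * real (Suc t) powr (- a)) * norm (A t - B t)"
      if t: "i \<le> t" "t < n" for t
    proof -
      have tn: "Suc t \<in> {1..n}" and Y: "Y (Suc t) = X (Suc t)" using t Yt[of "Suc t"] by auto
      \<comment> \<open>Strictness, from \<open>Suc t > i \<ge> 1\<close>, keeps the contraction factor positive even if \<open>\<gamma> = \<beta>\<close>.\<close>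
      have "real (Suc t) powr (- a) < real (Suc t) powr 0"
        using t i a by (intro powr_less_mono) auto
      then have lt: "real (Suc t) powr (- a) < 1" by simp
      have ab: "\<alpha> (Suc t) * \<beta> = real (Suc t) powr (- a)" and
        ag: "\<alpha> (Suc t) * \<gamma> = \<kappa> * real (Suc t) powr (- a)"
        using step[OF tn] assms(4) by (simp_all add: \<kappa>_def divide_inverse)
      have "\<kappa> * real (Suc t) powr (- a) \<le> 1 * real (Suc t) powr (- a)"
        using \<kappa> by (intro mult_right_mono) auto
      then have ag1: "\<alpha> (Suc t) * \<gamma> < 1" using lt ag by linarith
      have X: "X (Suc t) \<in> \<X>" using XX(1)[OF tn] .
      have AB: "A (Suc t) = A t - \<alpha> (Suc t) *\<^sub>R \<psi>' (A t) (X (Suc t))"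
        "B (Suc t) = B t - \<alpha> (Suc t) *\<^sub>R \<psi>' (B t) (X (Suc t))"
        using A B Y by auto
      show ?thesis unfolding ag[symmetric] AB
        by (rule feasible_gradient_step_contracts[OF S0 g[OF X] sc[OF X] lip[OF X] apos[OF tn] _ ag1])
          (use lt ab AS[of t] AS[of "Suc t"] BS[of t] BS[of "Suc t"] t AB in auto)
    qed
    have "norm (A m - B m) \<le> 2 * L / \<beta> * (real i powr (- a) * (\<Prod>t\<in>{i<..m}. 1 - \<kappa> * real t powr (- a)))"
      if "i \<le> m" "m \<le> n" for m
      using that
    proof (induction m rule: dec_induct)
      case base
      then show ?case using start by simp
    next
      case (step t)
      have f0: "0 \<le> 1 - \<kappa> * real (Suc t) powr (- a)" using a \<kappa> by (intro factor_nonneg) auto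
      have "norm (A (Suc t) - B (Suc t)) \<le> (1 - \<kappa> * real (Suc t) powr (- a)) * norm (A t - B t)"
        using step by (intro contr) auto
      also have "\<dots> \<le> (1 - \<kappa> * real (Suc t) powr (- a)) *
          (2 * L / \<beta> * (real i powr (- a) * (\<Prod>t\<in>{i<..t}. 1 - \<kappa> * real t powr (- a))))"
        using step f0 by (intro mult_left_mono) auto
      also have "{i<..Suc t} = insert (Suc t) {i<..t}" using step by auto
      then have "(1 - \<kappa> * real (Suc t) powr (- a)) *
          (2 * L / \<beta> * (real i powr (- a) * (\<Prod>t\<in>{i<..t}. 1 - \<kappa> * real t powr (- a))))
        = 2 * L / \<beta> * (real i powr (- a) * (\<Prod>t\<in>{i<..Suc t}. 1 - \<kappa> * real t powr (- a)))"
        by simp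
      finally show ?case .
    qed
    from this[of n] have "norm (A n - B n) \<le>
        2 * L / \<beta> * (real i powr (- a) * (\<Prod>t\<in>{i<..n}. 1 - \<kappa> * real t powr (- a)))"
      using i by simp
    also have "\<dots> \<le> 2 * L / \<beta> * real n powr (- a)"
      using factor_product_from[OF a \<kappa>, of i n] i big assms(4,5)
      by (intro mult_left_mono) (auto simp: \<kappa>_def)
    finally show ?thesis by (simp add: nabla_def A_def B_def Y_def)
  qed
qed

end
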